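(* Let $(\Omega,\Sigma,\mu)$ and $(\Omega,\Sigma,\nu)$ be two $\sigma$-finite measure spaces, let $p,q\in[1,+\infty]$, and let $g\in L_0(\Omega,\mu)$ be such that the multiplication operator $M_g:L_p(\Omega,\mu)\to L_q(\Omega,\nu)$, $f\mapsto g\cdot f$, is a well-defined bounded operator. Let $\Omega=\Omega_c\sqcup\Omega_s$ be the partition from the Lebesgue decomposition of $\nu$ with respect to $\mu$. Then the following are equivalent: i) $M_g\in\mathcal{B}(L_p(\Omega,\mu),L_q(\Omega,\nu))$ is isometric; ii) $M_{\chi_{\Omega_c}/g}$ is a well-defined bounded operator in $\mathcal{B}(L_q(\Omega,\nu),L_p(\Omega,\mu))$, it is a left inverse of $M_g$ (that is, $M_{\chi_{\Omega_c}/g}M_g=1_{L_p(\Omega,\mu)}$), and it is strictly coisometric.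
   Context: All linear spaces are over $\mathbb{C}$; measures are nonnegative, $\sigma$-additive, with values in $[0,+\infty]$. $L_0(\Omega,\mu)$ is the space of measurable complex functions on $\Omega$. Lebesgue decomposition of $\nu$ with respect to $\mu$: a nonnegative measurable function $\rho_{\nu,\mu}$, a $\sigma$-finite measure $\nu_s$ and a set $\Omega_s\in\Sigma$ such that $\nu=\rho_{\nu,\mu}\cdot\mu+\nu_s$ and $\mu(\Omega_s)=\nu_s(\Omega_c)=0$, where $\Omega_c=\Omega\setminus\Omega_s$ and $(\rho\cdot\mu)(E)=\int_E\rho\,d\mu$. $M_h$ denotes multiplication by the measurable function $h$. $\chi_{\Omega_c}$ is the indicator function of $\Omega_c$; $\chi_{\Omega_c}/g$ is the function equal to $1/g$ on $\Omega_c$ and $0$ elsewhere (with value $0$ also at points where $g=0$). An operator $T:X\to Y$ between normed spaces is isometric if $\|T(x)\|=\|x\|$ for all $x\in X$; it is strictly coisometric if it is contractive ($\|T\|\leq 1$) and for every $y\in Y$ there is $x\in X$ with $T(x)=y$ and $\|x\|\leq\|y\|$. *)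

theory Defs
  imports "HOL-Probability.Probability"
begin

text \<open>
  Complex normed spaces whose vectors form a subset of a type: the carrier of \<open>L\<^sub>p\<close> depends on
  the measure and on \<open>p\<close>, so it cannot be a type of its own.
\<close>

record 'v cnspace =
  vcarrier :: "'v set"
  vadd :: "'v \<Rightarrow> 'v \<Rightarrow> 'v"
  vscale :: "complex \<Rightarrow> 'v \<Rightarrow> 'v"
  vnorm :: "'v \<Rightarrow> real"

definition bounded_ops :: "'v cnspace \<Rightarrow> 'w cnspace \<Rightarrow> ('v \<Rightarrow> 'w) set" where
  "bounded_ops X Y = {T.
     (\<forall>x\<in>vcarrier X. T x \<in> vcarrier Y) \<and>
     (\<forall>x\<in>vcarrier X. \<forall>y\<in>vcarrier X. T (vadd X x y) = vadd Y (T x) (T y)) \<and>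
     (\<forall>c. \<forall>x\<in>vcarrier X. T (vscale X c x) = vscale Y c (T x)) \<and>
     (\<exists>C. \<forall>x\<in>vcarrier X. vnorm Y (T x) \<le> C * vnorm X x)}"

text \<open>The zero vector contributes \<open>0 / 0 = 0\<close> to the supremum, as in \<^const>\<open>onorm\<close>.\<close>

definition op_norm :: "'v cnspace \<Rightarrow> 'w cnspace \<Rightarrow> ('v \<Rightarrow> 'w) \<Rightarrow> real" where
  "op_norm X Y T = (SUP x\<in>vcarrier X. vnorm Y (T x) / vnorm X x)"

definition isometric_op :: "'v cnspace \<Rightarrow> 'w cnspace \<Rightarrow> ('v \<Rightarrow> 'w) \<Rightarrow> bool" where
  "isometric_op X Y T \<longleftrightarrow> T \<in> bounded_ops X Y \<and> (\<forall>x\<in>vcarrier X. vnorm Y (T x) = vnorm X x)"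

definition contractive_op :: "'v cnspace \<Rightarrow> 'w cnspace \<Rightarrow> ('v \<Rightarrow> 'w) \<Rightarrow> bool" where
  "contractive_op X Y T \<longleftrightarrow> T \<in> bounded_ops X Y \<and> op_norm X Y T \<le> 1"

definition strictly_coisometric_op :: "'v cnspace \<Rightarrow> 'w cnspace \<Rightarrow> ('v \<Rightarrow> 'w) \<Rightarrow> bool" where
  "strictly_coisometric_op X Y T \<longleftrightarrow> contractive_op X Y T \<and>
     (\<forall>y\<in>vcarrier Y. \<exists>x\<in>vcarrier X. T x = y \<and> vnorm X x \<le> vnorm Y y)"

definition ae_rel :: "'a measure \<Rightarrow> (('a \<Rightarrow> complex) \<times> ('a \<Rightarrow> complex)) set" where
  "ae_rel M = {(f, g). f \<in> borel_measurable M \<and> g \<in> borel_measurable M \<and> (AE x in M. f x = g x)}"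

abbreviation ae_class :: "'a measure \<Rightarrow> ('a \<Rightarrow> complex) \<Rightarrow> ('a \<Rightarrow> complex) set" where
  "ae_class M f \<equiv> ae_rel M `` {f}"

definition Lp_fun :: "ennreal \<Rightarrow> 'a measure \<Rightarrow> ('a \<Rightarrow> complex) set" where
  "Lp_fun p M = {f \<in> borel_measurable M.
     if p = \<infinity> then esssup M (\<lambda>x. ennreal (norm (f x))) < \<infinity>
     else integrable M (\<lambda>x. norm (f x) powr enn2real p)}"

definition Lp_norm :: "ennreal \<Rightarrow> 'a measure \<Rightarrow> ('a \<Rightarrow> complex) \<Rightarrow> real" where
  "Lp_norm p M f =
     (if p = \<infinity> then enn2real (esssup M (\<lambda>x. ennreal (norm (f x))))
      else (LINT x|M. norm (f x) powr enn2real p) powr (1 / enn2real p))"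

text \<open>Operations on classes act on representatives, in the idiom of \<^term>\<open>(respects)\<close>.\<close>

definition Lp :: "ennreal \<Rightarrow> 'a measure \<Rightarrow> ('a \<Rightarrow> complex) set cnspace" where
  "Lp p M = \<lparr>
     vcarrier = Lp_fun p M // ae_rel M,
     vadd = (\<lambda>F G. \<Union>f\<in>F. \<Union>g\<in>G. ae_class M (\<lambda>x. f x + g x)),
     vscale = (\<lambda>c F. \<Union>f\<in>F. ae_class M (\<lambda>x. c * f x)),
     vnorm = (\<lambda>F. the_elem (Lp_norm p M ` F))\<rparr>"

text \<open>
  The operator \<open>M\<^sub>h\<close> into a space of classes over \<open>N\<close>. The union is a single class exactly when
  \<open>h f\<close> does not depend, up to \<open>N\<close>-null sets, on the representative \<open>f\<close> of the argument.
\<close>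

definition mult_op :: "('a \<Rightarrow> complex) \<Rightarrow> 'a measure \<Rightarrow> ('a \<Rightarrow> complex) set \<Rightarrow> ('a \<Rightarrow> complex) set" where
  "mult_op h N F = (\<Union>f\<in>F. ae_class N (\<lambda>x. h x * f x))"

definition mult_op_well_defined ::
    "('a \<Rightarrow> complex) \<Rightarrow> ennreal \<Rightarrow> 'a measure \<Rightarrow> ennreal \<Rightarrow> 'a measure \<Rightarrow> bool" where
  "mult_op_well_defined h p M q N \<longleftrightarrow>
     (\<forall>f\<in>Lp_fun p M. (\<lambda>x. h x * f x) \<in> Lp_fun q N) \<and>
     (\<forall>f\<in>Lp_fun p M. \<forall>f'\<in>Lp_fun p M.
        (f, f') \<in> ae_rel M \<longrightarrow> (\<lambda>x. h x * f x, \<lambda>x. h x * f' x) \<in> ae_rel N)"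

definition lebesgue_decomposition ::
    "'a measure \<Rightarrow> 'a measure \<Rightarrow> ('a \<Rightarrow> real) \<Rightarrow> 'a measure \<Rightarrow> 'a set \<Rightarrow> bool" where
  "lebesgue_decomposition \<nu> \<mu> \<rho> \<nu>\<^sub>s \<Omega>\<^sub>s \<longleftrightarrow>
     \<rho> \<in> borel_measurable \<mu> \<and> (\<forall>x\<in>space \<mu>. 0 \<le> \<rho> x) \<and>
     sets \<nu>\<^sub>s = sets \<mu> \<and> sigma_finite_measure \<nu>\<^sub>s \<and> \<Omega>\<^sub>s \<in> sets \<mu> \<and>
     (\<forall>E\<in>sets \<mu>. emeasure \<nu> E = emeasure (density \<mu> (\<lambda>x. ennreal (\<rho> x))) E + emeasure \<nu>\<^sub>s E) \<and>
     emeasure \<mu> \<Omega>\<^sub>s = 0 \<and> emeasure \<nu>\<^sub>s (space \<mu> - \<Omega>\<^sub>s) = 0"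

lemma ae_rel_equiv: "equiv (borel_measurable M) (ae_rel M)"
proof (rule equivI)
  show "ae_rel M \<subseteq> borel_measurable M \<times> borel_measurable M"
    by (auto simp: ae_rel_def)
  show "refl_on (borel_measurable M) (ae_rel M)"
    by (auto simp: ae_rel_def refl_on_def)
  show "sym (ae_rel M)"
    by (auto simp: ae_rel_def intro!: symI elim: eventually_mono)
  show "trans (ae_rel M)"
    by (auto simp: ae_rel_def intro!: transI elim: eventually_elim2)
qed

lemma Lp_norm_cong:
  assumes "(f, g) \<in> ae_rel M"
  shows "Lp_norm p M f = Lp_norm p M g"
proof -
  have fg: "f \<in> borel_measurable M" "g \<in> borel_measurable M" "AE x in M. f x = g x"
    using assms by (simp_all add: ae_rel_def)
  have "esssup M (\<lambda>x. ennreal (norm (f x))) = esssup M (\<lambda>x. ennreal (norm (g x)))"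
    using fg(3) by (intro esssup_AE_cong) (use fg in \<open>auto elim: eventually_mono\<close>)
  moreover have "(LINT x|M. norm (f x) powr enn2real p) = (LINT x|M. norm (g x) powr enn2real p)"
    using fg(3) by (intro integral_cong_AE) (use fg in \<open>auto elim: eventually_mono\<close>)
  ultimately show ?thesis by (simp add: Lp_norm_def)
qed

lemma vnorm_Lp_class:
  assumes "f \<in> borel_measurable M"
  shows "vnorm (Lp p M) (ae_class M f) = Lp_norm p M f"
proof -
  have "(f, f) \<in> ae_rel M" using assms by (simp add: ae_rel_def)
  then have "Lp_norm p M ` ae_class M f = {Lp_norm p M f}"
    by (auto simp: image_iff dest: Lp_norm_cong[symmetric, of _ _ _ p] intro!: bexI[of _ f])
  then show ?thesis by (simp add: Lp_def)
qed

lemma mult_op_class: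
  assumes "mult_op_well_defined h p M q N" "f \<in> Lp_fun p M" "ae_class M f \<subseteq> Lp_fun p M"
  shows "mult_op h N (ae_class M f) = ae_class N (\<lambda>x. h x * f x)"
proof -
  have eq: "ae_class N (\<lambda>x. h x * g x) = ae_class N (\<lambda>x. h x * f x)" if "g \<in> ae_class M f" for g
  proof -
    have "(\<lambda>x. h x * f x, \<lambda>x. h x * g x) \<in> ae_rel N"
      using that assms by (simp add: mult_op_well_defined_def subset_iff)
    from equiv_class_eq[OF ae_rel_equiv this] show ?thesis by simp
  qed
  have f: "f \<in> ae_class M f" using assms(2) by (simp add: ae_rel_def Lp_fun_def)
  have "mult_op h N (ae_class M f) = (\<Union>g\<in>ae_class M f. ae_class N (\<lambda>x. h x * f x))"
    unfolding mult_op_def by (rule SUP_cong[OF refl eq])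
  also have "\<dots> = ae_class N (\<lambda>x. h x * f x)"
    using f by (rule UN_constant_eq) simp
  finally show ?thesis .
qed

end

theory Submission
  imports Defs
begin

text \<open>
  Both implications come from the pointwise estimate \<open>\<bar>g h y\<bar> \<le> \<bar>y\<bar>\<close>: the product \<open>g h\<close> is the
  indicator of the part of \<open>\<Omega>\<^sub>c\<close> on which \<open>g\<close> does not vanish.

  Suppose that \<open>M\<^sub>g\<close> is isometric. The difficulty is to see that \<open>h y\<close> lies in \<open>L\<^sub>p(\<mu>)\<close> at all for
  \<open>y \<in> L\<^sub>q(\<nu>)\<close>; once this is known, the isometry gives \<open>\<parallel>h y\<parallel> = \<parallel>g h y\<parallel> \<le> \<parallel>y\<parallel>\<close>. It follows from
  the fact that an isometric \<open>M\<^sub>g\<close> reflects closed balls (\<open>isometric_multiplication_reflects_balls\<close>):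
  if \<open>f\<close> is merely measurable and \<open>\<parallel>g f\<parallel> \<le> C\<close>, then \<open>f \<in> L\<^sub>p(\<mu>)\<close> and \<open>\<parallel>f\<parallel> \<le> C\<close>. To prove it,
  cut \<open>f\<close> down to bounded functions \<open>f\<^sub>n\<close> supported on sets of finite measure. These belong to
  \<open>L\<^sub>p(\<mu>)\<close>, so \<open>\<parallel>f\<^sub>n\<parallel> = \<parallel>g f\<^sub>n\<parallel> \<le> \<parallel>g f\<parallel> \<le> C\<close>, and the ball of radius \<open>C\<close> is closed under
  pointwise limits by Fatou's lemma (\<open>Lp_ball_pointwise_limit\<close>).

  The case \<open>C = 0\<close> says that \<open>f = 0\<close> holds \<open>\<mu>\<close>-almost everywhere as soon as \<open>g f = 0\<close> holds
  \<open>\<nu>\<close>-almost everywhere. Taking for \<open>f\<close> the indicator of \<open>{g = 0}\<close> shows that \<open>g \<noteq> 0\<close> almost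
  everywhere, so that \<open>h g f = f\<close> on the set \<open>\<Omega>\<^sub>c\<close> of full \<open>\<mu>\<close>-measure; taking \<open>f = h (y - y')\<close>
  shows that \<open>M\<^sub>h\<close> is well defined on classes. Finally \<open>g f\<close> is a preimage of \<open>f\<close> under \<open>M\<^sub>h\<close>
  with the same norm, so \<open>M\<^sub>h\<close> is strictly coisometric.

  Conversely, let \<open>M\<^sub>h\<close> be a strictly coisometric left inverse. Contractivity gives
  \<open>\<parallel>f\<parallel> = \<parallel>h g f\<parallel> \<le> \<parallel>g f\<parallel>\<close>. Writing \<open>f = h y\<close> with \<open>\<parallel>y\<parallel> \<le> \<parallel>f\<parallel>\<close> gives
  \<open>\<parallel>g f\<parallel> = \<parallel>g h y\<parallel> \<le> \<parallel>y\<parallel> \<le> \<parallel>f\<parallel>\<close>.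
\<close>

section \<open>Closed balls of \<open>L\<^sub>p\<close>\<close>

text \<open>
  Membership in \<open>L\<^sub>p\<close> and the norm bound are captured by one inequality on \<open>f\<close> in which nothing has
  to be known to be integrable beforehand. This is the form to which monotonicity and Fatou's lemma
  for \<open>[0, \<infinity>]\<close>-valued integrals apply.
\<close>

definition Lp_ball :: "ennreal \<Rightarrow> 'a measure \<Rightarrow> real \<Rightarrow> ('a \<Rightarrow> complex) set" where
  "Lp_ball p M C = {f \<in> borel_measurable M.
     if p = \<infinity> then AE x in M. norm (f x) \<le> C
     else (\<integral>\<^sup>+x. ennreal (norm (f x) powr enn2real p) \<partial>M) \<le> ennreal (C powr enn2real p)}"

lemma enn2real_pos_if_ge_1:
  fixes p :: ennreal
  assumes "1 \<le> p" "p \<noteq> \<infinity>"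
  shows "0 < enn2real p"
  using assms by (simp add: enn2real_positive_iff top.not_eq_extremum less_le_trans[of 0 1])

lemma Lp_norm_nonneg: "0 \<le> Lp_norm p M f"
  by (simp add: Lp_norm_def)

text \<open>
  For \<open>p = \<infinity>\<close> this holds because the essential supremum is itself an almost everywhere bound, for
  \<open>p < \<infinity>\<close> because \<open>t \<mapsto> t\<^sup>p\<close> is increasing on the nonnegative reals.
\<close>

lemma mem_Lp_ball_iff:
  assumes p: "1 \<le> p" and C: "0 \<le> C"
  shows "f \<in> Lp_ball p M C \<longleftrightarrow> f \<in> Lp_fun p M \<and> Lp_norm p M f \<le> C"
proof (cases "f \<in> borel_measurable M")
  case f [measurable]: True
  show ?thesis
  proof (cases "p = \<infinity>")
    case True
    let ?s = "esssup M (\<lambda>x. ennreal (norm (f x)))"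
    have "(AE x in M. norm (f x) \<le> C) \<longleftrightarrow> ?s \<le> ennreal C"
    proof
      assume "AE x in M. norm (f x) \<le> C"
      then show "?s \<le> ennreal C"
        by (intro esssup_I) (auto simp: ennreal_leI elim: eventually_mono)
    next
      assume s: "?s \<le> ennreal C"
      have "AE x in M. ennreal (norm (f x)) \<le> ?s"
        by (rule esssup_AE)
      then show "AE x in M. norm (f x) \<le> C"
        by eventually_elim (use s C in \<open>metis ennreal_le_iff order_trans\<close>)
    qed
    also have "\<dots> \<longleftrightarrow> ?s < \<infinity> \<and> enn2real ?s \<le> C"
      using C by (cases ?s) (auto simp: top_unique)
    finally show ?thesis
      using True by (simp add: Lp_ball_def Lp_fun_def Lp_norm_def)
  next
    case False
    let ?r = "enn2real p"
    let ?u = "\<lambda>x. norm (f x) powr ?r"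
    have r: "0 < ?r" using p False by (rule enn2real_pos_if_ge_1)
    have "(\<integral>\<^sup>+x. ennreal (?u x) \<partial>M) \<le> ennreal (C powr ?r) \<longleftrightarrow>
        integrable M ?u \<and> (LINT x|M. ?u x) \<le> C powr ?r" (is "?L \<longleftrightarrow> ?R")
    proof
      assume L: ?L
      then have "integrable M ?u"
        by (intro integrableI_nonneg) (auto simp: less_top[symmetric] top_unique)
      with L show ?R by (simp add: nn_integral_eq_integral)
    next
      assume ?R
      then show ?L by (simp add: nn_integral_eq_integral ennreal_leI)
    qed
    moreover have "I powr (1 / ?r) \<le> C \<longleftrightarrow> I \<le> C powr ?r" if I: "0 \<le> I" for I
    proof
      assume "I powr (1 / ?r) \<le> C"
      then have "(I powr (1 / ?r)) powr ?r \<le> C powr ?r"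
        using r by (intro powr_mono2) auto
      then show "I \<le> C powr ?r" using r I by (simp add: powr_powr)
    next
      assume "I \<le> C powr ?r"
      then have "I powr (1 / ?r) \<le> (C powr ?r) powr (1 / ?r)"
        using r I by (intro powr_mono2) auto
      then show "I powr (1 / ?r) \<le> C" using r C by (simp add: powr_powr)
    qed
    ultimately show ?thesis
      using False by (simp add: Lp_ball_def Lp_fun_def Lp_norm_def)
  qed
qed (simp add: Lp_ball_def Lp_fun_def)

lemma Lp_ball_norm:
  assumes "1 \<le> p" "f \<in> Lp_fun p M"
  shows "f \<in> Lp_ball p M (Lp_norm p M f)"
  using assms by (simp add: mem_Lp_ball_iff Lp_norm_nonneg)

lemma Lp_ball_solid:
  assumes f: "f \<in> Lp_ball p M C" and [measurable]: "k \<in> borel_measurable M"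
    and le: "AE x in M. norm (k x) \<le> norm (f x)"
  shows "k \<in> Lp_ball p M C"
proof -
  have [measurable]: "f \<in> borel_measurable M" using f by (simp add: Lp_ball_def)
  have "AE x in M. norm (k x) \<le> C" if "AE x in M. norm (f x) \<le> C"
    using le that by eventually_elim simp
  moreover have "(\<integral>\<^sup>+x. ennreal (norm (k x) powr enn2real p) \<partial>M)
      \<le> (\<integral>\<^sup>+x. ennreal (norm (f x) powr enn2real p) \<partial>M)"
    using le by (intro nn_integral_mono_AE)
      (auto intro!: ennreal_leI powr_mono2 elim!: eventually_mono)
  ultimately show ?thesis
    using f by (auto simp: Lp_ball_def intro: order_trans split: if_splits)
qed

lemma Lp_fun_ae_cong:
  assumes "1 \<le> p" "f \<in> Lp_fun p M" "(f, k) \<in> ae_rel M"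
  shows "k \<in> Lp_fun p M"
proof -
  have "k \<in> borel_measurable M" "AE x in M. norm (k x) \<le> norm (f x)"
    using assms(3) by (auto simp: ae_rel_def elim: eventually_mono)
  with Lp_ball_norm[OF assms(1,2)] have "k \<in> Lp_ball p M (Lp_norm p M f)"
    by (rule Lp_ball_solid)
  then show ?thesis using assms(1) by (simp add: mem_Lp_ball_iff Lp_norm_nonneg)
qed

lemma Lp_ball_0_iff:
  assumes "1 \<le> p"
  shows "f \<in> Lp_ball p M 0 \<longleftrightarrow> f \<in> borel_measurable M \<and> (AE x in M. f x = 0)"
proof (cases "p = \<infinity>")
  case False
  have "0 < enn2real p" using assms False by (rule enn2real_pos_if_ge_1)
  then show ?thesis
    using False by (auto simp: Lp_ball_def nn_integral_0_iff_AE)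
qed (simp add: Lp_ball_def)

text \<open>
  Fatou's lemma for \<open>p < \<infinity>\<close>; for \<open>p = \<infinity>\<close> the countably many exceptional null sets are merged into
  one.
\<close>

lemma Lp_ball_pointwise_limit:
  assumes p: "1 \<le> p" and F: "\<And>n. F n \<in> Lp_ball p M C" and f[measurable]: "f \<in> borel_measurable M"
    and lim: "\<And>x. x \<in> space M \<Longrightarrow> (\<lambda>n. F n x) \<longlonglongrightarrow> f x"
  shows "f \<in> Lp_ball p M C"
proof (cases "p = \<infinity>")
  case True
  have "AE x in M. \<forall>n. norm (F n x) \<le> C"
    using F True by (simp add: Lp_ball_def AE_all_countable)
  with AE_space have "AE x in M. norm (f x) \<le> C"
  proof eventually_elim
    case (elim x)
    then show ?case
      by (intro LIMSEQ_le_const2[OF tendsto_norm[OF lim[of x]]]) auto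
  qed
  then show ?thesis using True by (simp add: Lp_ball_def)
next
  case False
  let ?r = "enn2real p"
  have r: "0 < ?r" using p False by (rule enn2real_pos_if_ge_1)
  have [measurable]: "\<And>n. F n \<in> borel_measurable M" using F by (simp add: Lp_ball_def)
  have "(\<integral>\<^sup>+x. ennreal (norm (f x) powr ?r) \<partial>M)
      = (\<integral>\<^sup>+x. liminf (\<lambda>n. ennreal (norm (F n x) powr ?r)) \<partial>M)"
  proof (rule nn_integral_cong)
    fix x assume "x \<in> space M"
    then have "(\<lambda>n. ennreal (norm (F n x) powr ?r)) \<longlonglongrightarrow> ennreal (norm (f x) powr ?r)"
      using r by (intro tendsto_ennrealI tendsto_powr' tendsto_norm lim tendsto_const) auto
    then show "ennreal (norm (f x) powr ?r) = liminf (\<lambda>n. ennreal (norm (F n x) powr ?r))"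
      by (intro lim_imp_Liminf[symmetric]) auto
  qed
  also have "\<dots> \<le> liminf (\<lambda>n. \<integral>\<^sup>+x. ennreal (norm (F n x) powr ?r) \<partial>M)"
    by (intro nn_integral_liminf) simp
  also have "\<dots> \<le> liminf (\<lambda>n. ennreal (C powr ?r))"
    using F False by (intro Liminf_mono) (auto simp: Lp_ball_def)
  also have "\<dots> = ennreal (C powr ?r)" by (simp add: Liminf_const)
  finally show ?thesis using False by (simp add: Lp_ball_def)
qed

section \<open>Isometric multiplication operators\<close>

lemma bounded_finite_support_in_Lp_fun:
  assumes "1 \<le> p" "f \<in> borel_measurable M" "A \<in> sets M" "emeasure M A < \<infinity>"
    and B: "\<And>x. x \<in> space M \<Longrightarrow> norm (f x) \<le> B" and "\<And>x. x \<in> space M - A \<Longrightarrow> f x = 0"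
  shows "f \<in> Lp_fun p M"
proof (cases "p = \<infinity>")
  case True
  have "f \<in> Lp_ball p M (max 0 B)"
    using assms(2) B True by (auto simp: Lp_ball_def le_max_iff_disj intro!: AE_I2)
  then show ?thesis using assms(1) by (simp add: mem_Lp_ball_iff)
next
  case False
  have [measurable]: "f \<in> borel_measurable M" by fact
  have "integrable M (\<lambda>x. norm (f x) powr enn2real p)"
    using assms by (intro integrableI_bounded_set[where A=A and B="B powr enn2real p"])
      (auto intro!: AE_I2 powr_mono2)
  then show ?thesis using False by (simp add: Lp_fun_def)
qed

text \<open>
  The isometry speaks only of elements of \<open>L\<^sub>p\<close>, so it is applied to truncations of \<open>f\<close>. These stay in
  the ball because \<open>g\<close> times a truncation is dominated by \<open>g f\<close>, and they converge to \<open>f\<close> pointwise.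
\<close>

lemma isometric_multiplication_reflects_balls:
  assumes "sigma_finite_measure M" and sets: "sets N = sets M" and p: "1 \<le> p" and q: "1 \<le> q"
    and g: "g \<in> borel_measurable M"
    and wd: "\<And>f. f \<in> Lp_fun p M \<Longrightarrow> (\<lambda>x. g x * f x) \<in> Lp_fun q N"
    and iso: "\<And>f. f \<in> Lp_fun p M \<Longrightarrow> Lp_norm q N (\<lambda>x. g x * f x) = Lp_norm p M f"
    and C: "0 \<le> C" and f: "f \<in> borel_measurable M" and gf: "(\<lambda>x. g x * f x) \<in> Lp_ball q N C"
  shows "f \<in> Lp_ball p M C"
proof -
  interpret sigma_finite_measure M by fact
  obtain A :: "nat \<Rightarrow> 'a set" where A: "range A \<subseteq> sets M" "(\<Union>i. A i) = space M"
    "\<And>i. emeasure M (A i) \<noteq> \<infinity>" "incseq A"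
    by (rule sigma_finite_incseq) blast
  note g[measurable] f[measurable]
  have AM[measurable]: "\<And>i. A i \<in> sets M" using A(1) by auto
  define F where "F n x = f x * indicator (A n \<inter> {x \<in> space M. norm (f x) \<le> real n}) x" for n x
  have Fm[measurable]: "\<And>n. F n \<in> borel_measurable M"
    unfolding F_def by measurable
  have N: "borel_measurable N = (borel_measurable M :: ('a \<Rightarrow> complex) set)"
    using sets by (rule measurable_cong_sets) simp
  have F: "F n \<in> Lp_ball p M C" for n
  proof -
    have L: "F n \<in> Lp_fun p M"
      using A(3)[of n] p AM[of n]
      by (intro bounded_finite_support_in_Lp_fun[where A="A n" and B="real n"])
        (auto simp: F_def indicator_def less_top[symmetric])
    have "(\<lambda>x. g x * F n x) \<in> Lp_ball q N C"
      using gf by (rule Lp_ball_solid) (auto simp: N F_def indicator_def)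
    then have "Lp_norm q N (\<lambda>x. g x * F n x) \<le> C"
      using q C by (simp add: mem_Lp_ball_iff)
    then show ?thesis using L iso[OF L] p C by (simp add: mem_Lp_ball_iff)
  qed
  show ?thesis
  proof (rule Lp_ball_pointwise_limit[OF p F f])
    fix x assume x: "x \<in> space M"
    then obtain i where i: "x \<in> A i" using A(2) by auto
    obtain m where m: "norm (f x) \<le> real m" using real_arch_simple by blast
    have "F n x = f x" if "max i m \<le> n" for n
    proof -
      have "x \<in> A n" using i A(4) that by (auto simp: incseq_def)
      moreover have "norm (f x) \<le> real n" using m that by simp
      ultimately show ?thesis using x by (simp add: F_def)
    qed
    then show "(\<lambda>n. F n x) \<longlonglongrightarrow> f x"
      by (intro tendsto_eventually eventually_sequentiallyI[of "max i m"]) blast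
  qed
qed

section \<open>Operations on almost everywhere classes\<close>

lemma vcarrier_LpE:
  assumes "F \<in> vcarrier (Lp p M)"
  obtains f where "f \<in> Lp_fun p M" "F = ae_class M f"
  using assms by (auto simp: Lp_def elim: quotientE)

lemma ae_class_in_vcarrier: "f \<in> Lp_fun p M \<Longrightarrow> ae_class M f \<in> vcarrier (Lp p M)"
  by (simp add: Lp_def quotientI)

lemma vnorm_Lp:
  assumes "f \<in> Lp_fun p M"
  shows "vnorm (Lp p M) (ae_class M f) = Lp_norm p M f"
  using assms by (intro vnorm_Lp_class) (simp add: Lp_fun_def)

lemma ae_class_eq_iff:
  assumes "f \<in> borel_measurable M" "k \<in> borel_measurable M"
  shows "ae_class M f = ae_class M k \<longleftrightarrow> (AE x in M. f x = k x)"
  using eq_equiv_class_iff[OF ae_rel_equiv assms] assms by (simp add: ae_rel_def)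

lemma UN_ae_class_constant:
  assumes "f \<in> borel_measurable M" "\<And>k. (f, k) \<in> ae_rel M \<Longrightarrow> \<Phi> k = \<Phi> f"
  shows "(\<Union>k\<in>ae_class M f. \<Phi> k) = \<Phi> f"
proof -
  have "f \<in> ae_class M f" using assms(1) by (simp add: ae_rel_def)
  then have "(\<Union>k\<in>ae_class M f. \<Phi> f) = \<Phi> f" by (intro UN_constant_eq) auto
  moreover have "(\<Union>k\<in>ae_class M f. \<Phi> k) = (\<Union>k\<in>ae_class M f. \<Phi> f)"
    by (intro SUP_cong refl assms(2)) simp
  ultimately show ?thesis by (rule trans[rotated])
qed

text \<open>
  In contrast to \<open>mult_op_class\<close>, the argument is any measurable function, so that the formula
  applies to a sum of elements of \<open>L\<^sub>p\<close> before that sum is known to lie in \<open>L\<^sub>p\<close>.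
\<close>

lemma mult_op_ae_class:
  assumes abs_cont: "\<And>f f'. (f, f') \<in> ae_rel M \<Longrightarrow> (\<lambda>x. h x * f x, \<lambda>x. h x * f' x) \<in> ae_rel N"
    and "f \<in> borel_measurable M"
  shows "mult_op h N (ae_class M f) = ae_class N (\<lambda>x. h x * f x)"
  unfolding mult_op_def using assms(2)
  by (rule UN_ae_class_constant) (rule equiv_class_eq[OF ae_rel_equiv abs_cont, symmetric])

lemma vadd_ae_class:
  assumes [measurable]: "f \<in> borel_measurable M" "k \<in> borel_measurable M"
  shows "vadd (Lp p M) (ae_class M f) (ae_class M k) = ae_class M (\<lambda>x. f x + k x)"
proof -
  have *: "ae_class M (\<lambda>x. f' x + k' x) = ae_class M (\<lambda>x. f x + k x)"
    if "(f, f') \<in> ae_rel M" "(k, k') \<in> ae_rel M" for f' k'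
  proof -
    have [measurable]: "f' \<in> borel_measurable M" "k' \<in> borel_measurable M"
      and "AE x in M. f x = f' x" "AE x in M. k x = k' x"
      using that by (auto simp: ae_rel_def)
    then show ?thesis by (subst ae_class_eq_iff) (auto elim: eventually_elim2)
  qed
  have refl: "(f, f) \<in> ae_rel M" "(k, k) \<in> ae_rel M" by (simp_all add: ae_rel_def)
  have "(\<Union>k'\<in>ae_class M k. ae_class M (\<lambda>x. f' x + k' x)) = ae_class M (\<lambda>x. f' x + k x)"
    if "(f, f') \<in> ae_rel M" for f'
    by (rule UN_ae_class_constant[OF assms(2)]) (metis *[OF that] refl(2))
  then have "(\<Union>f'\<in>ae_class M f. \<Union>k'\<in>ae_class M k. ae_class M (\<lambda>x. f' x + k' x))
      = (\<Union>f'\<in>ae_class M f. ae_class M (\<lambda>x. f' x + k x))"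
    by (intro SUP_cong) auto
  also have "\<dots> = ae_class M (\<lambda>x. f x + k x)"
    by (subst UN_ae_class_constant[OF assms(1)]) (simp_all add: *[OF _ refl(2)])
  finally show ?thesis by (simp add: Lp_def)
qed

lemma vscale_ae_class:
  assumes [measurable]: "f \<in> borel_measurable M"
  shows "vscale (Lp p M) c (ae_class M f) = ae_class M (\<lambda>x. c * f x)"
proof -
  have "ae_class M (\<lambda>x. c * k x) = ae_class M (\<lambda>x. c * f x)" if "(f, k) \<in> ae_rel M" for k
  proof -
    have [measurable]: "k \<in> borel_measurable M" and "AE x in M. k x = f x"
      using that by (auto simp: ae_rel_def elim: eventually_mono)
    then show ?thesis by (subst ae_class_eq_iff) auto
  qed
  with assms have "(\<Union>k\<in>ae_class M f. ae_class M (\<lambda>x. c * k x)) = ae_class M (\<lambda>x. c * f x)"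
    by (rule UN_ae_class_constant)
  then show ?thesis by (simp add: Lp_def)
qed

section \<open>Contractive operators\<close>

text \<open>
  Boundedness of the operator enters twice: it makes the quotients bounded above, so that their
  supremum in \<open>\<real>\<close> is meaningful, and it settles vectors of norm \<open>0\<close>, whose quotient \<open>0\<close> carries no
  information.
\<close>

lemma contractive_op_vnorm_le:
  assumes "contractive_op X Y T" "x \<in> vcarrier X" and nonneg: "\<And>x. x \<in> vcarrier X \<Longrightarrow> 0 \<le> vnorm X x"
  shows "vnorm Y (T x) \<le> vnorm X x"
proof -
  obtain C where C: "\<And>x. x \<in> vcarrier X \<Longrightarrow> vnorm Y (T x) \<le> C * vnorm X x"
    using assms(1) unfolding contractive_op_def bounded_ops_def by blast
  have "bdd_above ((\<lambda>x. vnorm Y (T x) / vnorm X x) ` vcarrier X)"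
  proof (rule bdd_aboveI2)
    fix x assume "x \<in> vcarrier X"
    then show "vnorm Y (T x) / vnorm X x \<le> max 0 C"
      using C[of x] nonneg[of x] by (cases "vnorm X x = 0") (auto simp: field_simps le_max_iff_disj)
  qed
  then have "vnorm Y (T x) / vnorm X x \<le> op_norm X Y T"
    unfolding op_norm_def using assms(2) by (rule cSUP_upper2) simp
  also have "\<dots> \<le> 1" using assms(1) by (simp add: contractive_op_def)
  finally show ?thesis
    using C[OF assms(2)] nonneg[OF assms(2)] by (cases "vnorm X x = 0") (auto simp: field_simps)
qed

lemma contractive_opI:
  assumes "T \<in> bounded_ops X Y" "vcarrier X \<noteq> {}"
    and "\<And>x. x \<in> vcarrier X \<Longrightarrow> 0 \<le> vnorm X x"
    and "\<And>x. x \<in> vcarrier X \<Longrightarrow> vnorm Y (T x) \<le> vnorm X x"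
  shows "contractive_op X Y T"
proof -
  have "vnorm Y (T x) / vnorm X x \<le> 1" if "x \<in> vcarrier X" for x
    using assms(3,4)[OF that] by (cases "vnorm X x = 0") (auto simp: field_simps)
  then show ?thesis
    using assms(1,2) by (auto simp: contractive_op_def op_norm_def intro!: cSUP_least)
qed

section \<open>Isometric and strictly coisometric multiplication operators\<close>

theorem theorem2p2p4:
  fixes \<mu> \<nu> \<nu>\<^sub>s :: "'a measure" and p q :: ennreal and g :: "'a \<Rightarrow> complex"
    and \<rho> :: "'a \<Rightarrow> real" and \<Omega>\<^sub>s \<Omega>\<^sub>c :: "'a set"
  assumes "sigma_finite_measure \<mu>" and "sigma_finite_measure \<nu>" and "sets \<nu> = sets \<mu>"
    and "1 \<le> p" and "1 \<le> q"
    and "g \<in> borel_measurable \<mu>"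
    and "mult_op_well_defined g p \<mu> q \<nu>" and "mult_op g \<nu> \<in> bounded_ops (Lp p \<mu>) (Lp q \<nu>)"
    and "lebesgue_decomposition \<nu> \<mu> \<rho> \<nu>\<^sub>s \<Omega>\<^sub>s" and "\<Omega>\<^sub>c = space \<mu> - \<Omega>\<^sub>s"
  defines "h \<equiv> \<lambda>x. indicator \<Omega>\<^sub>c x / g x"
  shows "isometric_op (Lp p \<mu>) (Lp q \<nu>) (mult_op g \<nu>) \<longleftrightarrow>
    mult_op_well_defined h q \<nu> p \<mu> \<and>
    mult_op h \<mu> \<in> bounded_ops (Lp q \<nu>) (Lp p \<mu>) \<and>
    (\<forall>F\<in>vcarrier (Lp p \<mu>). mult_op h \<mu> (mult_op g \<nu> F) = F) \<and>
    strictly_coisometric_op (Lp q \<nu>) (Lp p \<mu>) (mult_op h \<mu>)"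
proof -
  note assms(6)[measurable]
  have bN: "borel_measurable \<nu> = (borel_measurable \<mu> :: ('a \<Rightarrow> complex) set)"
    using assms(3) by (rule measurable_cong_sets) simp
  have p: "1 \<le> p" and q: "1 \<le> q" by fact+
  have \<Omega>s[measurable]: "\<Omega>\<^sub>s \<in> sets \<mu>" and null: "emeasure \<mu> \<Omega>\<^sub>s = 0"
    using assms(9) by (auto simp: lebesgue_decomposition_def)
  have [measurable]: "\<Omega>\<^sub>c \<in> sets \<mu>" using assms(10) by simp
  have h[measurable]: "h \<in> borel_measurable \<mu>" unfolding h_def by measurable
  have AE_c: "AE x in \<mu>. x \<in> \<Omega>\<^sub>c"
    using AE_not_in[OF null_setsI[OF null \<Omega>s]] AE_space
    by eventually_elim (simp add: assms(10))
  \<comment> \<open>Where \<open>g\<close> vanishes, so does the product \<open>g h\<close>; hence \<open>g h\<close> only takes the values \<open>0\<close> and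
    \<open>1\<close>.\<close>
  have gh_le: "norm (g x * (h x * c)) \<le> norm c" for x c
    by (simp add: h_def indicator_def)
  have meas: "f \<in> borel_measurable \<mu>" if "f \<in> Lp_fun r M" "M = \<mu> \<or> M = \<nu>" for f r M
    using that bN by (auto simp: Lp_fun_def)
  have wd: "(\<lambda>x. g x * f x) \<in> Lp_fun q \<nu>" if "f \<in> Lp_fun p \<mu>" for f
    using assms(7) that by (simp add: mult_op_well_defined_def)
  have Mg: "mult_op g \<nu> (ae_class \<mu> f) = ae_class \<nu> (\<lambda>x. g x * f x)" if "f \<in> Lp_fun p \<mu>" for f
    using assms(7) that by (rule mult_op_class) (use Lp_fun_ae_cong[OF p that] in auto)
  have vnorm_nonneg: "0 \<le> vnorm (Lp r M) F" if "F \<in> vcarrier (Lp r M)"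
    for F r and M :: "'a measure"
    using that by (auto elim!: vcarrier_LpE simp: vnorm_Lp Lp_norm_nonneg)
  show ?thesis
  proof
    assume "isometric_op (Lp p \<mu>) (Lp q \<nu>) (mult_op g \<nu>)"
    then have isoF: "vnorm (Lp q \<nu>) (mult_op g \<nu> F) = vnorm (Lp p \<mu>) F"
      if "F \<in> vcarrier (Lp p \<mu>)" for F
      using that by (simp add: isometric_op_def)
    have iso: "Lp_norm q \<nu> (\<lambda>x. g x * f x) = Lp_norm p \<mu> f" if f: "f \<in> Lp_fun p \<mu>" for f
      using isoF[OF ae_class_in_vcarrier[OF f]] by (simp add: Mg f wd vnorm_Lp)
    note reflect = isometric_multiplication_reflects_balls[OF assms(1,3) p q assms(6) wd iso]
    \<comment> \<open>Balls of radius \<open>0\<close> consist of the functions that vanish almost everywhere.\<close>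
    have reflect_0: "AE x in \<mu>. f x = 0"
      if "f \<in> borel_measurable \<mu>" "AE x in \<nu>. g x * f x = 0" for f
      using reflect[of 0 f] that p q by (simp add: Lp_ball_0_iff bN)
    have "AE x in \<mu>. indicator {x \<in> space \<mu>. g x = 0} x = (0 :: complex)"
      by (rule reflect_0) (auto simp: indicator_def)
    with AE_space have g_nz: "AE x in \<mu>. g x \<noteq> 0"
      by eventually_elim (auto simp: indicator_def)
    \<comment> \<open>The isometry cannot be applied to \<open>h y\<close> directly, since \<open>h y\<close> is not yet known to be in
      \<open>L\<^sub>p(\<mu>)\<close>.\<close>
    have h_ball: "(\<lambda>x. h x * y x) \<in> Lp_ball p \<mu> (Lp_norm q \<nu> y)" if y: "y \<in> Lp_fun q \<nu>" for y
    proof (rule reflect)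
      have [measurable]: "y \<in> borel_measurable \<mu>" using y meas by blast
      show "(\<lambda>x. g x * (h x * y x)) \<in> Lp_ball q \<nu> (Lp_norm q \<nu> y)"
        using Lp_ball_norm[OF q y] by (rule Lp_ball_solid) (auto simp: bN gh_le)
      show "(\<lambda>x. h x * y x) \<in> borel_measurable \<mu>" by measurable
    qed (simp_all add: Lp_norm_nonneg)
    have h_Lp: "(\<lambda>x. h x * y x) \<in> Lp_fun p \<mu>" "Lp_norm p \<mu> (\<lambda>x. h x * y x) \<le> Lp_norm q \<nu> y"
      if "y \<in> Lp_fun q \<nu>" for y
      using h_ball[OF that] p by (simp_all add: mem_Lp_ball_iff Lp_norm_nonneg)
    have h_ae: "(\<lambda>x. h x * y x, \<lambda>x. h x * y' x) \<in> ae_rel \<mu>" if "(y, y') \<in> ae_rel \<nu>" for y y'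
    proof -
      have [measurable]: "y \<in> borel_measurable \<mu>" "y' \<in> borel_measurable \<mu>"
        and eq: "AE x in \<nu>. y x = y' x"
        using that by (auto simp: ae_rel_def bN)
      have "AE x in \<mu>. h x * (y x - y' x) = 0"
        by (rule reflect_0) (use eq in \<open>auto elim: eventually_mono\<close>)
      then have "AE x in \<mu>. h x * y x = h x * y' x"
        by eventually_elim (auto simp: algebra_simps)
      then show ?thesis by (simp add: ae_rel_def)
    qed
    have Mh: "mult_op h \<mu> (ae_class \<nu> y) = ae_class \<mu> (\<lambda>x. h x * y x)"
      if "y \<in> borel_measurable \<mu>" for y
      using mult_op_ae_class[OF h_ae] that by (simp add: bN)
    have Mh_le: "vnorm (Lp p \<mu>) (mult_op h \<mu> Y) \<le> vnorm (Lp q \<nu>) Y"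
      if "Y \<in> vcarrier (Lp q \<nu>)" for Y
      using that by (auto elim!: vcarrier_LpE simp: Mh meas h_Lp vnorm_Lp)
    have wdh: "mult_op_well_defined h q \<nu> p \<mu>"
      using h_Lp h_ae by (auto simp: mult_op_well_defined_def)
    have bounded: "mult_op h \<mu> \<in> bounded_ops (Lp q \<nu>) (Lp p \<mu>)"
    proof -
      have "mult_op h \<mu> Y \<in> vcarrier (Lp p \<mu>)" if "Y \<in> vcarrier (Lp q \<nu>)" for Y
        using that by (auto elim!: vcarrier_LpE simp: Mh meas h_Lp ae_class_in_vcarrier)
      moreover have "mult_op h \<mu> (vadd (Lp q \<nu>) Y Z) =
          vadd (Lp p \<mu>) (mult_op h \<mu> Y) (mult_op h \<mu> Z)"
        if Y: "Y \<in> vcarrier (Lp q \<nu>)" and Z: "Z \<in> vcarrier (Lp q \<nu>)" for Y Z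
      proof -
        obtain y where "y \<in> Lp_fun q \<nu>" "Y = ae_class \<nu> y"
          using Y by (rule vcarrier_LpE)
        moreover obtain z where "z \<in> Lp_fun q \<nu>" "Z = ae_class \<nu> z"
          using Z by (rule vcarrier_LpE)
        moreover from calculation have [measurable]: "y \<in> borel_measurable \<mu>" "z \<in> borel_measurable \<mu>"
          using meas by blast+
        ultimately show ?thesis
          by (simp add: vadd_ae_class bN Mh distrib_left)
      qed
      moreover have "mult_op h \<mu> (vscale (Lp q \<nu>) c Y) = vscale (Lp p \<mu>) c (mult_op h \<mu> Y)"
        if Y: "Y \<in> vcarrier (Lp q \<nu>)" for c Y
      proof -
        obtain y where "y \<in> Lp_fun q \<nu>" "Y = ae_class \<nu> y"
          using Y by (rule vcarrier_LpE)
        moreover from calculation have [measurable]: "y \<in> borel_measurable \<mu>"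
          using meas by blast
        ultimately show ?thesis
          by (simp add: vscale_ae_class bN Mh mult.left_commute)
      qed
      moreover have "\<exists>C. \<forall>Y\<in>vcarrier (Lp q \<nu>).
          vnorm (Lp p \<mu>) (mult_op h \<mu> Y) \<le> C * vnorm (Lp q \<nu>) Y"
        using Mh_le by (intro exI[of _ 1]) simp
      ultimately show ?thesis by (simp add: bounded_ops_def)
    qed
    have left_inv: "mult_op h \<mu> (mult_op g \<nu> F) = F" if "F \<in> vcarrier (Lp p \<mu>)" for F
    proof -
      obtain f where f: "f \<in> Lp_fun p \<mu>" "F = ae_class \<mu> f"
        using \<open>F \<in> vcarrier (Lp p \<mu>)\<close> by (rule vcarrier_LpE)
      have [measurable]: "f \<in> borel_measurable \<mu>" using f(1) meas by blast
      have "AE x in \<mu>. h x * (g x * f x) = f x"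
        using AE_c g_nz by eventually_elim (simp add: h_def)
      then show ?thesis using f by (simp add: Mg Mh ae_class_eq_iff)
    qed
    have g_carrier: "mult_op g \<nu> F \<in> vcarrier (Lp q \<nu>)" if "F \<in> vcarrier (Lp p \<mu>)" for F
      using assms(8) that by (simp add: bounded_ops_def)
    \<comment> \<open>The supremum that defines the operator norm must range over a nonempty carrier.\<close>
    have "(\<lambda>x. 0) \<in> Lp_fun q \<nu>"
      using q by (intro bounded_finite_support_in_Lp_fun[where A="{}" and B=0]) auto
    then have "contractive_op (Lp q \<nu>) (Lp p \<mu>) (mult_op h \<mu>)"
      using ae_class_in_vcarrier by (intro contractive_opI[OF bounded _ vnorm_nonneg Mh_le]) blast
    \<comment> \<open>The preimage of \<open>F\<close> under \<open>M\<^sub>h\<close> is \<open>g F\<close>.\<close>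
    then have "strictly_coisometric_op (Lp q \<nu>) (Lp p \<mu>) (mult_op h \<mu>)"
      unfolding strictly_coisometric_op_def using left_inv g_carrier isoF
      by (metis order_refl)
    then show "mult_op_well_defined h q \<nu> p \<mu> \<and>
      mult_op h \<mu> \<in> bounded_ops (Lp q \<nu>) (Lp p \<mu>) \<and>
      (\<forall>F\<in>vcarrier (Lp p \<mu>). mult_op h \<mu> (mult_op g \<nu> F) = F) \<and>
      strictly_coisometric_op (Lp q \<nu>) (Lp p \<mu>) (mult_op h \<mu>)"
      using wdh bounded left_inv by blast
  next
    assume R: "mult_op_well_defined h q \<nu> p \<mu> \<and>
      mult_op h \<mu> \<in> bounded_ops (Lp q \<nu>) (Lp p \<mu>) \<and>
      (\<forall>F\<in>vcarrier (Lp p \<mu>). mult_op h \<mu> (mult_op g \<nu> F) = F) \<and>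
      strictly_coisometric_op (Lp q \<nu>) (Lp p \<mu>) (mult_op h \<mu>)"
    then have wdh: "mult_op_well_defined h q \<nu> p \<mu>"
      and left_inv: "\<And>F. F \<in> vcarrier (Lp p \<mu>) \<Longrightarrow> mult_op h \<mu> (mult_op g \<nu> F) = F"
      and contr: "contractive_op (Lp q \<nu>) (Lp p \<mu>) (mult_op h \<mu>)"
      and lift: "\<And>F. F \<in> vcarrier (Lp p \<mu>) \<Longrightarrow>
        \<exists>Y\<in>vcarrier (Lp q \<nu>). mult_op h \<mu> Y = F \<and> vnorm (Lp q \<nu>) Y \<le> vnorm (Lp p \<mu>) F"
      by (auto simp: strictly_coisometric_op_def)
    have "vnorm (Lp q \<nu>) (mult_op g \<nu> F) = vnorm (Lp p \<mu>) F" if F: "F \<in> vcarrier (Lp p \<mu>)" for F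
    proof (rule antisym)
      \<comment> \<open>For \<open>F\<close> represented by \<open>h y\<close>, the product \<open>g F\<close> is represented by \<open>g h y\<close>, which is
        dominated by \<open>y\<close>.\<close>
      obtain Y where Y: "Y \<in> vcarrier (Lp q \<nu>)" "mult_op h \<mu> Y = F"
        "vnorm (Lp q \<nu>) Y \<le> vnorm (Lp p \<mu>) F"
        using lift[OF F] by blast
      obtain y where y: "y \<in> Lp_fun q \<nu>" "Y = ae_class \<nu> y"
        using Y(1) by (rule vcarrier_LpE)
      have [measurable]: "y \<in> borel_measurable \<mu>" using y(1) meas by blast
      have hy: "(\<lambda>x. h x * y x) \<in> Lp_fun p \<mu>"
        using wdh y(1) by (simp add: mult_op_well_defined_def)
      have "F = ae_class \<mu> (\<lambda>x. h x * y x)"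
        using mult_op_class[OF wdh y(1)] Lp_fun_ae_cong[OF q y(1)] Y(2) y(2) by blast
      then have "vnorm (Lp q \<nu>) (mult_op g \<nu> F) = Lp_norm q \<nu> (\<lambda>x. g x * (h x * y x))"
        using hy by (simp add: Mg wd vnorm_Lp)
      also have "\<dots> \<le> Lp_norm q \<nu> y"
      proof -
        have "(\<lambda>x. g x * (h x * y x)) \<in> Lp_ball q \<nu> (Lp_norm q \<nu> y)"
          using Lp_ball_norm[OF q y(1)] by (rule Lp_ball_solid) (auto simp: bN gh_le)
        then show ?thesis using q by (simp add: mem_Lp_ball_iff Lp_norm_nonneg)
      qed
      also have "\<dots> = vnorm (Lp q \<nu>) Y" using y by (simp add: vnorm_Lp)
      finally show "vnorm (Lp q \<nu>) (mult_op g \<nu> F) \<le> vnorm (Lp p \<mu>) F" using Y(3) by simp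
    next
      have "mult_op g \<nu> F \<in> vcarrier (Lp q \<nu>)"
        using assms(8) F by (simp add: bounded_ops_def)
      from contractive_op_vnorm_le[OF contr this vnorm_nonneg]
      show "vnorm (Lp p \<mu>) F \<le> vnorm (Lp q \<nu>) (mult_op g \<nu> F)"
        by (simp add: left_inv F)
    qed
    then show "isometric_op (Lp p \<mu>) (Lp q \<nu>) (mult_op g \<nu>)"
      using assms(8) by (simp add: isometric_op_def)
  qed
qed

end
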